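(* The quadratic dependence on $[w]_{A_1}$ in the weighted weak type $(1,1)$ estimate \[ |\{x\in\mathbb{R}^d: w(x)|T(fw^{-1})(x)|>\alpha\}|\le \frac{C[w]_{A_1}^2}{\alpha}\int_{\mathbb{R}^d}|f|\,dx \] is sharp in the scalar setting, both for $T=H$ (the Hilbert transform) and for $T=M$ (the Hardy--Littlewood maximal operator). Precisely: there is an absolute constant $c>0$ and a sequence of weights $w_N\in A_1(\mathbb{R})$ with $[w_N]_{A_1}\to\infty$ such that for each $N$ there is a nonzero $f_N\in L^1(\mathbb{R})$ with \[ \sup_{\alpha>0}\alpha\,\big|\{x\in\mathbb{R}: w_N(x)|T(f_Nw_N^{-1})(x)|>\alpha\}\big|\ge c\,[w_N]_{A_1}^2\int_{\mathbb{R}}|f_N|\,dx \] for both $T=H$ and $T=M$. In particular, for neither operator can $[w]_{A_1}^2$ be replaced by $\varphi([w]_{A_1})$ with $\varphi(t)/t^2\to0$ as $t\to\infty$.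
   Context: A weight is a non-negative locally integrable function $w$. It belongs to $A_1$ if there is $C>0$ with $\frac{1}{|Q|}\int_Q w\le C\,\operatorname{ess\,inf}_Q w$ for every cube (in dimension one: interval) $Q$; the smallest such $C$ is $[w]_{A_1}$. The Hardy--Littlewood maximal operator is $Mf(x)=\sup_{Q\ni x}\frac1{|Q|}\int_Q|f|$, and the Hilbert transform is $Hf(x)=\mathrm{p.v.}\int_{\mathbb{R}}\frac{f(y)}{x-y}\,dy$ (the normalizing constant is irrelevant). *)

theory Defs
  imports "HOL-Analysis.Analysis"
begin

definition is_weight :: "(real \<Rightarrow> real) \<Rightarrow> bool" where
  "is_weight w \<longleftrightarrow> (\<forall>x. 0 \<le> w x) \<and> (\<forall>a b. set_integrable lborel {a..b} w)"

definition ess_inf_on :: "(real \<Rightarrow> real) \<Rightarrow> real set \<Rightarrow> real" where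
  "ess_inf_on w S = Sup {t. AE x in lborel. x \<in> S \<longrightarrow> t \<le> w x}"

definition A1_cond :: "(real \<Rightarrow> real) \<Rightarrow> real \<Rightarrow> bool" where
  "A1_cond w C \<longleftrightarrow> (\<forall>a b. a < b \<longrightarrow>
      (LINT x:{a..b}|lborel. w x) / (b - a) \<le> C * ess_inf_on w {a..b})"

definition in_A1 :: "(real \<Rightarrow> real) \<Rightarrow> bool" where
  "in_A1 w \<longleftrightarrow> is_weight w \<and> (\<exists>C>0. A1_cond w C)"

definition A1_const :: "(real \<Rightarrow> real) \<Rightarrow> real" where
  "A1_const w = Inf {C. C > 0 \<and> A1_cond w C}"

definition maximal_fn :: "(real \<Rightarrow> real) \<Rightarrow> real \<Rightarrow> ennreal" where
  "maximal_fn f x = (SUP ab \<in> {(a, b). a < b \<and> x \<in> {a..b}}.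
      ennreal (1 / (snd ab - fst ab)) * (\<integral>\<^sup>+ y \<in> {fst ab..snd ab}. ennreal \<bar>f y\<bar> \<partial>lborel))"

text \<open>L is the principal value Hilbert transform of g at x (constant 1/pi omitted):
  the truncated integrals exist for small eps and converge to L as eps tends to 0+.\<close>
definition hilbert_pv :: "(real \<Rightarrow> real) \<Rightarrow> real \<Rightarrow> real \<Rightarrow> bool" where
  "hilbert_pv g x L \<longleftrightarrow>
     (\<forall>\<^sub>F \<epsilon> in at_right 0. set_integrable lborel {y. \<epsilon> < \<bar>x - y\<bar>} (\<lambda>y. g y / (x - y))) \<and>
     ((\<lambda>\<epsilon>. LINT y:{y. \<epsilon> < \<bar>x - y\<bar>}|lborel. g y / (x - y)) \<longlongrightarrow> L) (at_right 0)"

definition level_M :: "(real \<Rightarrow> real) \<Rightarrow> (real \<Rightarrow> real) \<Rightarrow> real \<Rightarrow> real set" where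
  "level_M w f \<alpha> = {x. ennreal \<alpha> < ennreal (w x) * maximal_fn (\<lambda>y. f y / w y) x}"

definition level_H :: "(real \<Rightarrow> real) \<Rightarrow> (real \<Rightarrow> real) \<Rightarrow> real \<Rightarrow> real set" where
  "level_H w f \<alpha> = {x. \<exists>L. hilbert_pv (\<lambda>y. f y / w y) x L \<and> \<alpha> < w x * \<bar>L\<bar>}"

end

(* The weight is 1 plus, for each of n dyadic points 2^k, a peak of profile 2^k / |x - 2^k|, cut off
   at distance about 2^k and replaced by the larger value n 2^k on the unit neighbourhood of 2^k.
   The hyperbolic tail, having about k scales, and the central plateau both carry mass of order
   n 2^k, so the jump by the factor n costs no more than an A_1 constant of order n.  On the other
   hand f = 1 on [0,1] gives M f and |H f| at least 1/x for x > 1, so that w M f and w |H f| exceed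
   n/2 on all n plateaus, a set of measure 2n: the weak type quotient is at least n^2. *)
theory Submission
  imports Defs
begin

section \<open>The peak profile: pointwise bounds and mass\<close>

definition peak :: "nat \<Rightarrow> real \<Rightarrow> real \<Rightarrow> real" where
  "peak n R u = (if \<bar>u\<bar> \<le> 1 then n * R else if \<bar>u\<bar> \<le> R / 8 then R / \<bar>u\<bar> else 0)"

text \<open>Starting at \<open>k = 3\<close> gives \<open>2^k / 8 \<ge> 1\<close>, keeps every peak
  away from \<open>{0..1}\<close> and makes the plateaus disjoint. Stopping at \<open>n + 2\<close>
  gives \<open>n\<close> peaks, with \<open>ln (2^k / 8) \<le> n\<close> for each.\<close>

definition peaks_weight :: "nat \<Rightarrow> real \<Rightarrow> real" where
  "peaks_weight n x = 1 + (\<Sum>k=3..n+2. peak n (2^k) (x - 2^k))"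

lemma peak_nonneg: "0 \<le> R \<Longrightarrow> 0 \<le> peak n R u"
  by (simp add: peak_def)

lemma peak_measurable [measurable]: "peak n R \<in> borel_measurable borel"
  unfolding peak_def by measurable

lemma peak_le_height:
  assumes "0 \<le> R" "1 \<le> n"
  shows "peak n R u \<le> n * R"
proof -
  have "R / \<bar>u\<bar> \<le> n * R" if "\<bar>u\<bar> > 1"
  proof -
    have "R / \<bar>u\<bar> \<le> R / 1"
      using assms that by (intro divide_left_mono) auto
    also have "\<dots> \<le> n * R"
      using assms mult_right_mono[of 1 "real n" R] by simp
    finally show ?thesis .
  qed
  then show ?thesis
    using assms by (auto simp: peak_def)
qed

lemma peak_le_hyperbola:
  assumes "0 \<le> R" "1 \<le> n" "u \<noteq> 0"
  shows "peak n R u \<le> n * R / \<bar>u\<bar>"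
proof -
  have "n * R \<le> n * R / \<bar>u\<bar>" if "\<bar>u\<bar> \<le> 1"
    using assms that by (simp add: le_divide_eq mult_left_le)
  moreover have "R / \<bar>u\<bar> \<le> n * R / \<bar>u\<bar>"
    using assms mult_right_mono[of 1 "real n" R] by (intro divide_right_mono) auto
  ultimately show ?thesis
    using assms by (auto simp: peak_def)
qed

text \<open>Where the tail is cut off, the constant 1 takes over, since
  \<open>R / (8 * \<bar>u\<bar>)\<close> is below 1 beyond \<open>R / 8\<close>. One plus a peak
  thus dominates a hyperbola without cut-off.\<close>

lemma one_plus_peak_ge:
  assumes "0 \<le> R" "1 \<le> \<bar>u\<bar>" "1 \<le> n"
  shows "R / (8 * \<bar>u\<bar>) \<le> 1 + peak n R u"
proof -
  have "R / (8 * \<bar>u\<bar>) \<le> R / \<bar>u\<bar>"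
    using assms by (intro divide_left_mono) auto
  moreover have "R / (8 * \<bar>u\<bar>) \<le> 1" if "R / 8 < \<bar>u\<bar>"
    using assms that by (simp add: divide_le_eq)
  moreover have "R \<le> n * R * 8"
    using assms mult_right_mono[of 1 "real n * 8" R] by simp
  ultimately show ?thesis
    using assms by (auto simp: peak_def not_le)
qed

text \<open>The plateau has mass \<open>2 * n * R\<close> and the two tails together
  \<open>2 * R * ln (R / 8)\<close>; the hypothesis on the logarithm makes the tails no heavier than
  the plateau.\<close>

lemma peak_integral:
  assumes "1 \<le> n" "8 \<le> R" "ln (R / 8) \<le> n"
  shows "integrable lborel (peak n R)" "(LINT u|lborel. peak n R u) \<le> 4 * real n * R"
proof -
  \<comment> \<open>A majorant built on closed intervals; it exceeds the peak only at the shared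
    endpoints -1 and 1.\<close>
  define h where "h = (\<lambda>u::real. n * R * indicator {-1..1} u
     + R * (1 / u * indicator {1..R/8} u) + R * (- 1 / u * indicator {-(R/8)..-1} u))"
  have 1: "has_bochner_integral lborel (\<lambda>u::real. 1 / u * indicator {1..R/8} u) (ln (R/8) - ln 1)"
    using assms
    by (intro has_bochner_integral_FTC_Icc_nonneg) (auto intro!: derivative_eq_intros)
  have 2: "has_bochner_integral lborel (\<lambda>u::real. - 1 / u * indicator {-(R/8)..-1} u)
      (- ln (- (-1)) - (- ln (- (-(R/8)))))"
    using assms
    by (intro has_bochner_integral_FTC_Icc_nonneg[where F="\<lambda>u. - ln (- u)"])
       (auto intro!: derivative_eq_intros simp: field_simps)
  have 3: "has_bochner_integral lborel (indicator {-1..1::real} :: real \<Rightarrow> real) 2"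
    using has_bochner_integral_real_indicator[of "{-1..1::real}" lborel] by simp
  have "has_bochner_integral lborel h (n * R * 2 + R * (ln (R/8) - ln 1)
      + R * (- ln (- (-1)) - (- ln (- (-(R/8))))))"
    unfolding h_def
    by (intro has_bochner_integral_add has_bochner_integral_mult_right 1 2 3)
  then have h: "integrable lborel h" "(LINT u|lborel. h u) = n * R * 2 + 2 * R * ln (R/8)"
    by (auto simp: has_bochner_integral_iff)
  have le: "peak n R u \<le> h u" for u
    using assms by (auto simp: peak_def h_def indicator_def)
  show int: "integrable lborel (peak n R)"
    by (rule Bochner_Integration.integrable_bound[OF h(1)])
       (use assms in \<open>auto simp: peak_nonneg intro!: order_trans[OF le]\<close>)
  have "(LINT u|lborel. peak n R u) \<le> n * R * 2 + 2 * R * ln (R/8)"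
    unfolding h(2)[symmetric] by (intro integral_mono int h le)
  also have "\<dots> \<le> n * R * 2 + 2 * R * n"
    using assms by (intro add_left_mono mult_left_mono) auto
  finally show "(LINT u|lborel. peak n R u) \<le> 4 * real n * R" by (simp add: mult_ac)
qed

lemma dyadic_peak_integral:
  assumes "1 \<le> n" "k \<in> {3..n+2}"
  shows "integrable lborel (\<lambda>x. peak n (2^k) (x - 2^k))"
    "(LINT x|lborel. peak n (2^k) (x - 2^k)) \<le> 4 * real n * 2^k"
proof -
  define j where "j = k - 3"
  have j: "k = j + 3" "j < n" using assms by (auto simp: j_def)
  have "(1::real) \<le> 2^j" by simp
  then have 8: "8 \<le> (2::real)^k" by (simp add: j power_add)
  have "ln ((2::real)^k / 8) = j * ln 2" by (simp add: j power_add ln_realpow)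
  also have "\<dots> \<le> real n * 1"
    using j ln_le_minus_one[of "2::real"] by (intro mult_mono) auto
  finally have l: "ln ((2::real)^k / 8) \<le> n" by simp
  note p = peak_integral[OF assms(1) 8 l]
  show "integrable lborel (\<lambda>x. peak n (2^k) (x - 2^k))"
    using lborel_integrable_real_affine[OF p(1), of 1 "- (2^k)"] by (simp add: algebra_simps)
  show "(LINT x|lborel. peak n (2^k) (x - 2^k)) \<le> 4 * real n * 2^k"
    using p(2) lborel_integral_real_affine[of 1 "peak n (2^k)" "- (2^k)"] by (simp add: algebra_simps)
qed

lemma peaks_weight_measurable [measurable]: "peaks_weight n \<in> borel_measurable borel"
  unfolding peaks_weight_def by measurable

lemma peaks_weight_ge_one: "1 \<le> peaks_weight n x"
  by (simp add: peaks_weight_def sum_nonneg peak_nonneg)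

lemma peaks_weight_ge_peak: "k \<in> {3..n+2} \<Longrightarrow> 1 + peak n (2^k) (x - 2^k) \<le> peaks_weight n x"
  unfolding peaks_weight_def
  by (intro add_left_mono member_le_sum) (auto simp: peak_nonneg)

lemma peaks_weight_le:
  assumes "1 \<le> n"
  shows "peaks_weight n x \<le> 1 + (\<Sum>k=3..n+2. real n * 2^k)"
  unfolding peaks_weight_def using assms
  by (intro add_left_mono sum_mono peak_le_height) auto

text \<open>All peaks are supported in \<open>x \<ge> 7\<close>. Hence dividing the test function
  \<open>indicator {0..1}\<close> by the weight leaves it unchanged, and the weight has small values
  to set against the plateaus.\<close>

lemma peaks_weight_unit_interval:
  assumes "x \<in> {0..1}"
  shows "peaks_weight n x = 1"
proof -
  have "peak n (2^k) (x - 2^k) = 0" if "k \<in> {3..n+2}" for k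
  proof -
    have "(2::real)^3 \<le> 2^k" using that by (intro power_increasing) auto
    then show ?thesis using assms by (auto simp: peak_def abs_if)
  qed
  then show ?thesis by (simp add: peaks_weight_def)
qed

lemma peaks_weight_set_integrable:
  assumes "1 \<le> n"
  shows "set_integrable lborel {a..b} (peaks_weight n)"
  unfolding set_integrable_def
proof (rule integrableI_bounded_set[where A="{a..b}" and B="1 + (\<Sum>k=3..n+2. real n * 2^k)"])
  show "AE x in lborel. x \<in> {a..b} \<longrightarrow>
      norm (indicator {a..b} x *\<^sub>R peaks_weight n x) \<le> 1 + (\<Sum>k=3..n+2. real n * 2^k)"
    using peaks_weight_le[OF assms] order_trans[OF zero_le_one peaks_weight_ge_one]
    by (auto simp: indicator_def)
qed (auto simp: emeasure_lborel_Icc_eq)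

section \<open>The A_1 averages: peaks far from a point and near to it\<close>

text \<open>For \<open>i < j\<close> the windows are separated because
  \<open>5/4 * 2^i < 3/4 * 2^(i+1)\<close>.\<close>

lemma dyadic_window_unique:
  fixes y :: real
  assumes "\<bar>y - 2^k\<bar> \<le> 2^k / 4" "\<bar>y - 2^l\<bar> \<le> 2^l / 4"
  shows "k = l"
proof -
  have False if "i < j" "\<bar>y - 2^i\<bar> \<le> 2^i / 4" "\<bar>y - 2^j\<bar> \<le> 2^j / 4" for i j :: nat
  proof -
    have "(2::real) ^ Suc i \<le> 2 ^ j" using that by (intro power_increasing) auto
    moreover have "(0::real) < 2^i" by simp
    ultimately show False using that(2,3) unfolding abs_le_iff power_Suc by linarith
  qed
  then show ?thesis using assms by (metis linorder_neqE_nat)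
qed

text \<open>Here \<open>y\<close> and \<open>z\<close> are offsets from the centre of one peak. The
  separation forces \<open>\<bar>z\<bar> \<ge> \<bar>y\<bar> / 2\<close>, so passing from
  \<open>z\<close> to \<open>y\<close> costs a factor 2 in the hyperbola; the remaining 8 comes from
  \<open>one_plus_peak_ge\<close> and \<open>n\<close> from the height of the plateau.\<close>

lemma far_peak_le:
  assumes "1 \<le> n" "8 \<le> R" "\<bar>z - y\<bar> \<le> L" "2 * L < \<bar>y\<bar>"
  shows "peak n R z \<le> of_bool (\<bar>y\<bar> \<le> R / 4) * (16 * real n * (1 + peak n R y))"
proof -
  have z: "\<bar>y\<bar> / 2 \<le> \<bar>z\<bar>" "0 < \<bar>y\<bar>" using assms by (auto simp: abs_if split: if_splits)
  have R: "0 \<le> R" using assms by simp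
  have p: "0 \<le> peak n R y" using R by (rule peak_nonneg)
  show ?thesis
  proof (cases "\<bar>y\<bar> \<le> R / 4")
    case False
    \<comment> \<open>Now \<open>\<bar>z\<bar> > R / 8 \<ge> 1\<close>, so \<open>z\<close> is past
      both the plateau and the cut-off.\<close>
    then have "peak n R z = 0" using z assms by (simp add: peak_def)
    then show ?thesis using False by simp
  next
    case window: True
    have "peak n R z \<le> 16 * real n * (1 + peak n R y)"
    \<comment> \<open>On the plateau the value at \<open>y\<close> is already the maximum of the
      peak; off it the hyperbolas are compared.\<close>
    proof (cases "\<bar>y\<bar> \<le> 1")
      case True
      then have "peak n R z \<le> peak n R y"
        using peak_le_height[OF R assms(1)] by (simp add: peak_def)
      also have "\<dots> \<le> (16 * real n) * (1 + peak n R y)"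
        using assms p mult_mono[of 1 "16 * real n" "peak n R y" "1 + peak n R y"] by simp
      finally show ?thesis by simp
    next
      case False
      have "peak n R z \<le> n * R / \<bar>z\<bar>"
        using z assms by (intro peak_le_hyperbola) auto
      also have "\<dots> \<le> n * R / (\<bar>y\<bar> / 2)"
        using z R by (intro divide_left_mono) auto
      also have "\<dots> = 16 * real n * (R / (8 * \<bar>y\<bar>))" by simp
      also have "\<dots> \<le> 16 * real n * (1 + peak n R y)"
        using False assms by (intro mult_left_mono one_plus_peak_ge) auto
      finally show ?thesis .
    qed
    then show ?thesis using window by simp
  qed
qed

lemma dyadic_ge_8: "k \<in> {3..n+2} \<Longrightarrow> 8 \<le> (2::real)^k"
  using power_increasing[of 3 k "2::real"] by simp

text \<open>By \<open>far_peak_le\<close> a far peak is non-zero at \<open>z\<close> only if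
  \<open>y\<close> lies in its window, and by \<open>dyadic_window_unique\<close> this happens for
  at most one peak, so the number of peaks costs no factor.\<close>

lemma far_peaks_le:
  assumes "1 \<le> n" "\<bar>z - y\<bar> \<le> L" "B = {k\<in>{3..n+2}. 2 * L < \<bar>y - 2^k\<bar>}"
  shows "(\<Sum>k\<in>B. peak n (2^k) (z - 2^k)) \<le> 16 * real n * peaks_weight n y"
proof (cases "\<exists>k\<in>B. \<bar>y - 2^k\<bar> \<le> 2^k / 4")
  have *: "peak n (2^k) (z - 2^k)
      \<le> of_bool (\<bar>y - 2^k\<bar> \<le> 2^k / 4) * (16 * real n * (1 + peak n (2^k) (y - 2^k)))" if "k \<in> B" for k
    using assms that by (intro far_peak_le[where L=L] dyadic_ge_8[of k n]) auto
  case True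
  then obtain l where l: "l \<in> B" "\<bar>y - 2^l\<bar> \<le> 2^l / 4" by auto
  have "(\<Sum>k\<in>B. peak n (2^k) (z - 2^k)) \<le> (\<Sum>k\<in>B. if k = l then 16 * real n * peaks_weight n y else 0)"
  proof (rule sum_mono)
    fix k assume k: "k \<in> B"
    show "peak n (2^k) (z - 2^k) \<le> (if k = l then 16 * real n * peaks_weight n y else 0)"
    proof (cases "k = l")
      case True
      have "16 * real n * (1 + peak n (2^k) (y - 2^k)) \<le> 16 * real n * peaks_weight n y"
        using k assms by (intro mult_left_mono peaks_weight_ge_peak) auto
      with *[OF k] l True show ?thesis by simp
    next
      case False
      then have "\<not> \<bar>y - 2^k\<bar> \<le> 2^k / 4" using dyadic_window_unique l by blast
      with *[OF k] False show ?thesis by simp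
    qed
  qed
  also have "\<dots> = 16 * real n * peaks_weight n y"
    using l assms by (simp add: sum.delta)
  finally show ?thesis .
next
  case False
  have "peak n (2^k) (z - 2^k) \<le> 0" if "k \<in> B" for k
    using far_peak_le[OF assms(1) dyadic_ge_8[of k n], of "z - 2^k" "y - 2^k" L] that False assms by auto
  then have "(\<Sum>k\<in>B. peak n (2^k) (z - 2^k)) \<le> 0" by (intro sum_nonpos) auto
  also have "0 \<le> 16 * real n * peaks_weight n y"
    using peaks_weight_ge_one[of n y] by simp
  finally show ?thesis .
qed

lemma sum_dyadic_le:
  fixes A :: "nat set"
  assumes "A \<subseteq> {..m}"
  shows "(\<Sum>k\<in>A. (2::real)^k) \<le> 2 * 2^m"
proof -
  have "(\<Sum>k\<in>A. (2::real)^k) \<le> (\<Sum>k\<le>m. 2^k)"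
    using assms by (intro sum_mono2) auto
  also have "\<dots> = 2^Suc m - 1"
    by (simp add: lessThan_Suc_atMost[symmetric] geometric_sum del: lessThan_Suc)
  finally show ?thesis by simp
qed

text \<open>The largest near index \<open>m\<close> governs the geometric sum, so only the position
  of \<open>y\<close> relative to peak \<open>m\<close> matters. The factor \<open>b - a\<close>
  comes from the length of the interval if \<open>y\<close> is on that plateau, and from
  \<open>\<bar>y - 2^m\<bar> \<le> 2 * (b - a)\<close> otherwise.\<close>

lemma near_peaks_integral_le:
  assumes "1 \<le> n" "a < b" "A = {k\<in>{3..n+2}. \<bar>y - 2^k\<bar> \<le> 2 * (b - a)}"
  shows "(\<Sum>k\<in>A. LINT x:{a..b}|lborel. peak n (2^k) (x - 2^k)) \<le> 128 * real n * (b - a) * peaks_weight n y"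
proof (cases "A = {}")
  case True
  then show ?thesis using assms(1,2) peaks_weight_ge_one[of n y] by (simp del: atLeastAtMost_iff)
next
  case False
  define m where "m = Max A"
  have "finite A" using assms by simp
  then have m: "m \<in> A" "A \<subseteq> {..m}" using False by (auto simp: m_def)
  have mm: "m \<in> {3..n+2}" "\<bar>y - 2^m\<bar> \<le> 2 * (b - a)" using m assms by auto
  have int: "set_integrable lborel {a..b} (\<lambda>x. peak n (2^k) (x - 2^k))" if "k \<in> A" for k
    using dyadic_peak_integral(1)[of n k] that assms
    unfolding set_integrable_def by (intro integrable_mult_indicator) auto
  have weight: "1 + peak n (2^m) (y - 2^m) \<le> peaks_weight n y"
    by (rule peaks_weight_ge_peak[OF mm(1)])
  show ?thesis
  proof (cases "\<bar>y - 2^m\<bar> \<le> 1")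
    case True
    \<comment> \<open>Height times length is used here, because the total mass does not shrink with
      the interval.\<close>
    have "(LINT x:{a..b}|lborel. peak n (2^k) (x - 2^k)) \<le> real n * 2^k * (b - a)" if "k \<in> A" for k
    proof -
      have "(LINT x:{a..b}|lborel. peak n (2^k) (x - 2^k)) \<le> (LINT x:{a..b}|lborel. real n * 2^k)"
        using assms that by (intro set_integral_mono int peak_le_height) (auto simp: set_integrable_def)
      then show ?thesis using assms(2) by (simp add: set_integral_const mult_ac)
    qed
    then have "(\<Sum>k\<in>A. LINT x:{a..b}|lborel. peak n (2^k) (x - 2^k)) \<le> (\<Sum>k\<in>A. real n * 2^k * (b - a))"
      by (rule sum_mono)
    also have "\<dots> = n * (b - a) * (\<Sum>k\<in>A. 2^k)"
      by (simp add: sum_distrib_left mult_ac)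
    also have "\<dots> \<le> n * (b - a) * (2 * 2^m)"
      using assms by (intro mult_left_mono sum_dyadic_le m) auto
    also have "\<dots> = 2 * (b - a) * peak n (2^m) (y - 2^m)"
      using True by (simp add: peak_def)
    also have "\<dots> \<le> 2 * (b - a) * peaks_weight n y"
      using weight assms by (intro mult_left_mono) auto
    also have "\<dots> \<le> 128 * real n * (b - a) * peaks_weight n y"
      using assms peaks_weight_ge_one[of n y] by (intro mult_right_mono) auto
    finally show ?thesis .
  next
    case False
    have "(LINT x:{a..b}|lborel. peak n (2^k) (x - 2^k)) \<le> 4 * real n * 2^k" if "k \<in> A" for k
    proof -
      have "(LINT x:{a..b}|lborel. peak n (2^k) (x - 2^k)) \<le> (LINT x|lborel. peak n (2^k) (x - 2^k))"
        unfolding set_lebesgue_integral_def using dyadic_peak_integral(1)[of n k] int that assms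
        by (intro integral_mono) (auto simp: set_integrable_def indicator_def peak_nonneg)
      also have "\<dots> \<le> 4 * real n * 2^k"
        using that assms by (intro dyadic_peak_integral) auto
      finally show ?thesis .
    qed
    then have "(\<Sum>k\<in>A. LINT x:{a..b}|lborel. peak n (2^k) (x - 2^k)) \<le> (\<Sum>k\<in>A. 4 * real n * 2^k)"
      by (rule sum_mono)
    also have "\<dots> = 4 * real n * (\<Sum>k\<in>A. 2^k)"
      by (simp add: sum_distrib_left)
    also have "\<dots> \<le> 4 * real n * (2 * 2^m)"
      by (intro mult_left_mono sum_dyadic_le m) auto
    \<comment> \<open>The distance to the centre is split off, to be paid for by
      \<open>2 * (b - a)\<close>; the remaining hyperbola lies below the weight at
      \<open>y\<close>.\<close>
    also have "\<dots> = 64 * real n * (\<bar>y - 2^m\<bar> * (2^m / (8 * \<bar>y - 2^m\<bar>)))"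
      using False by simp
    also have "\<dots> \<le> 64 * real n * ((2 * (b - a)) * peaks_weight n y)"
    proof (intro mult_left_mono mult_mono mm)
      have "2^m / (8 * \<bar>y - 2^m\<bar>) \<le> 1 + peak n (2^m) (y - 2^m)"
        using False assms by (intro one_plus_peak_ge) auto
      with weight show "2^m / (8 * \<bar>y - 2^m\<bar>) \<le> peaks_weight n y" by simp
    qed (use assms in auto)
    finally show ?thesis by (simp add: algebra_simps)
  qed
qed

text \<open>Peaks centred within twice the interval length of \<open>y\<close> are controlled by the total mass, which is
  geometric in the largest one; the others vary slowly on the interval, and at most one of them
  is non-zero there.\<close>
lemma peaks_weight_average_le:
  assumes "1 \<le> n" "a < b" "y \<in> {a..b}"
  shows "(LINT x:{a..b}|lborel. peaks_weight n x) \<le> 145 * real n * (b - a) * peaks_weight n y"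
proof -
  define A where "A = {k\<in>{3..n+2}. \<bar>y - 2^k\<bar> \<le> 2 * (b - a)}"
  define B where "B = {k\<in>{3..n+2}. 2 * (b - a) < \<bar>y - 2^k\<bar>}"
  have AB: "{3..n+2} = A \<union> B" "A \<inter> B = {}" "finite A" "finite B"
    by (auto simp: A_def B_def)
  have int: "set_integrable lborel {a..b} (\<lambda>x. peak n (2^k) (x - 2^k))" if "k \<in> A" for k
    unfolding set_integrable_def
    by (intro integrable_mult_indicator dyadic_peak_integral(1)[of n k]) (use that assms(1) in \<open>auto simp: A_def\<close>)
  have intA: "set_integrable lborel {a..b} (\<lambda>x. \<Sum>k\<in>A. peak n (2^k) (x - 2^k))"
    unfolding set_integrable_def scaleR_sum_right
    using int by (intro Bochner_Integration.integrable_sum) (simp add: set_integrable_def)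
  have const: "set_integrable lborel {a..b} (\<lambda>x. c)" for c :: real
    using integrable_real_indicator[of "{a..b}" lborel] by (simp add: set_integrable_def emeasure_lborel_Icc_eq)
  have "(LINT x:{a..b}|lborel. peaks_weight n x)
      \<le> (LINT x:{a..b}|lborel. (1 + 16 * real n * peaks_weight n y) + (\<Sum>k\<in>A. peak n (2^k) (x - 2^k)))"
  proof (intro set_integral_mono set_integral_add intA const peaks_weight_set_integrable assms)
    fix x assume x: "x \<in> {a..b}"
    have "(\<Sum>k\<in>B. peak n (2^k) (x - 2^k)) \<le> 16 * real n * peaks_weight n y"
      using assms x by (intro far_peaks_le[where L="b - a"]) (auto simp: B_def)
    then show "peaks_weight n x
        \<le> (1 + 16 * real n * peaks_weight n y) + (\<Sum>k\<in>A. peak n (2^k) (x - 2^k))"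
      unfolding peaks_weight_def[of n x] AB(1) sum.union_disjoint[OF AB(3,4,2)] by simp
  qed
  also have "\<dots> = (1 + 16 * real n * peaks_weight n y) * (b - a)
      + (\<Sum>k\<in>A. LINT x:{a..b}|lborel. peak n (2^k) (x - 2^k))"
  proof -
    have "(LINT x:{a..b}|lborel. (\<Sum>k\<in>A. peak n (2^k) (x - 2^k)))
        = (\<Sum>k\<in>A. LINT x:{a..b}|lborel. peak n (2^k) (x - 2^k))"
      unfolding set_lebesgue_integral_def scaleR_sum_right
      using int by (intro Bochner_Integration.integral_sum) (simp add: set_integrable_def)
    then show ?thesis
      using assms by (subst set_integral_add(2)[OF const intA]) (simp add: set_integral_const)
  qed
  also have "\<dots> \<le> (1 + 16 * real n * peaks_weight n y) * (b - a) + 128 * real n * (b - a) * peaks_weight n y"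
    using assms by (intro add_left_mono near_peaks_integral_le) (auto simp: A_def)
  \<comment> \<open>The constant is absorbed through \<open>1 \<le> n * peaks_weight n y\<close>,
    which gives \<open>1 + 16 + 128 = 145\<close>.\<close>
  also have "\<dots> \<le> (n * peaks_weight n y + 16 * real n * peaks_weight n y) * (b - a) + 128 * real n * (b - a) * peaks_weight n y"
    using assms peaks_weight_ge_one[of n y] mult_mono[of 1 "real n" 1 "peaks_weight n y"]
    by (intro add_right_mono mult_right_mono) auto
  finally show ?thesis by (simp add: algebra_simps)
qed

section \<open>The A_1 constant, bounded from both sides\<close>

lemma AE_lborel_Icc_witness:
  fixes a b :: real
  assumes "AE x in lborel. x \<in> {a..b} \<longrightarrow> P x" "a < b"
  shows "\<exists>x\<in>{a..b}. P x"
proof (rule ccontr)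
  assume "\<not> ?thesis"
  with assms(1) have "AE x in lborel. x \<notin> {a..b}" by (auto elim: eventually_mono)
  then have "emeasure lborel {a..b} = 0" by (subst (asm) AE_iff_measurable[of "{a..b}"]) auto
  with assms(2) show False by simp
qed

text \<open>The bound \<open>B\<close> makes the set of essential lower bounds bounded above, as
  \<open>Sup\<close> on the reals requires.\<close>

lemma le_ess_inf_on:
  assumes "a < b" "\<And>x. x \<in> {a..b} \<Longrightarrow> t \<le> w x" "\<And>x. w x \<le> B"
  shows "t \<le> ess_inf_on w {a..b}"
  unfolding ess_inf_on_def
proof (rule cSup_upper)
  show "bdd_above {t. AE x in lborel. x \<in> {a..b} \<longrightarrow> t \<le> w x}"
  proof (rule bdd_aboveI[of _ B])
    fix s assume "s \<in> {t. AE x in lborel. x \<in> {a..b} \<longrightarrow> t \<le> w x}"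
    then have "AE x in lborel. x \<in> {a..b} \<longrightarrow> s \<le> w x" by simp
    from AE_lborel_Icc_witness[OF this assms(1)] obtain x where "s \<le> w x" by auto
    then show "s \<le> B" using assms(3)[of x] by simp
  qed
qed (use assms in auto)

lemma peaks_weight_A1_cond:
  assumes "1 \<le> n"
  shows "A1_cond (peaks_weight n) (145 * real n)"
  unfolding A1_cond_def
proof (intro allI impI)
  fix a b :: real assume ab: "a < b"
  have "(LINT x:{a..b}|lborel. peaks_weight n x) / (145 * real n * (b - a)) \<le> ess_inf_on (peaks_weight n) {a..b}"
  proof (rule le_ess_inf_on[OF ab])
    fix y assume "y \<in> {a..b}"
    then show "(LINT x:{a..b}|lborel. peaks_weight n x) / (145 * real n * (b - a)) \<le> peaks_weight n y"
      using peaks_weight_average_le[OF assms ab] assms ab by (simp add: divide_le_eq mult_ac)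
  qed (rule peaks_weight_le[OF assms])
  then show "(LINT x:{a..b}|lborel. peaks_weight n x) / (b - a) \<le> 145 * real n * ess_inf_on (peaks_weight n) {a..b}"
    using assms ab by (simp add: field_simps)
qed

text \<open>A subinterval of positive length already caps the essential infimum; the lower bound
  \<open>s\<close> makes the set under \<open>Sup\<close> nonempty.\<close>

lemma ess_inf_on_le:
  assumes "a < b" "c < d" "{c..d} \<subseteq> {a..b}" "\<And>x. x \<in> {c..d} \<Longrightarrow> w x \<le> t" "\<And>x. s \<le> w x"
  shows "ess_inf_on w {a..b} \<le> t"
  unfolding ess_inf_on_def
proof (rule cSup_least)
  fix r assume "r \<in> {t. AE x in lborel. x \<in> {a..b} \<longrightarrow> t \<le> w x}"
  then have "AE x in lborel. x \<in> {c..d} \<longrightarrow> r \<le> w x"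
    using assms(3) by (auto elim!: eventually_mono)
  from AE_lborel_Icc_witness[OF this assms(2)] obtain x where "x \<in> {c..d}" "r \<le> w x"
    by auto
  then show "r \<le> t" using assms(4)[of x] by simp
qed (use assms(5) in auto)

lemma peaks_weight_near_peak:
  assumes "k \<in> {3..n+2}" "\<bar>x - 2^k\<bar> \<le> 1"
  shows "1 + real n * 2^k \<le> peaks_weight n x"
  using peaks_weight_ge_peak[OF assms(1), of x] assms(2) by (simp add: peak_def)

text \<open>The test interval runs from 0 to the end of the last plateau. That plateau contributes
  at least \<open>2 * n * 2^K\<close> over a length of at most \<open>2 * 2^K\<close>, so the
  average is at least \<open>n\<close>, while \<open>{0..1}\<close> keeps the essential infimum at
  most 1.\<close>

lemma A1_cond_peaks_weight_ge:
  assumes "1 \<le> n" "0 < C" "A1_cond (peaks_weight n) C"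
  shows "n \<le> C"
proof -
  define K where "K = n + 2"
  have K: "K \<in> {3..n+2}" "8 \<le> (2::real)^K" using assms dyadic_ge_8[of K n] by (auto simp: K_def)
  define b :: real where "b = 2^K + 1"
  have "n * b \<le> n * (2::real)^K * 2" using K by (simp add: b_def)
  also have "\<dots> = (LINT x:{2^K-1..(2::real)^K+1}|lborel. real n * 2^K)"
    by (simp add: set_integral_const)
  also have "\<dots> \<le> (LINT x:{2^K-1..(2::real)^K+1}|lborel. peaks_weight n x)"
  proof (intro set_integral_mono peaks_weight_set_integrable assms)
    fix x :: real assume "x \<in> {2^K-1..2^K+1}"
    then have "\<bar>x - 2^K\<bar> \<le> 1" by (auto simp: abs_if)
    from peaks_weight_near_peak[OF K(1) this] show "real n * 2^K \<le> peaks_weight n x" by simp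
  qed (auto simp: set_integrable_def)
  also have "\<dots> \<le> (LINT x:{0..b}|lborel. peaks_weight n x)"
    unfolding set_lebesgue_integral_def
    using K peaks_weight_set_integrable[OF assms(1)] order_trans[OF zero_le_one peaks_weight_ge_one]
    by (intro integral_mono) (auto simp: set_integrable_def indicator_def b_def)
  finally have "n \<le> (LINT x:{0..b}|lborel. peaks_weight n x) / (b - 0)"
    using K by (simp add: b_def le_divide_eq)
  also have "\<dots> \<le> C * ess_inf_on (peaks_weight n) {0..b}"
    using assms(3)[unfolded A1_cond_def, rule_format, of 0 b] K by (simp add: b_def)
  also have "\<dots> \<le> C * 1"
    using assms K peaks_weight_ge_one
    by (intro mult_left_mono ess_inf_on_le[where c=0 and d=1]) (auto simp: b_def peaks_weight_unit_interval)
  finally show ?thesis by simp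
qed

lemma in_A1_peaks_weight: "1 \<le> n \<Longrightarrow> in_A1 (peaks_weight n)"
  unfolding in_A1_def is_weight_def
  by (intro conjI allI exI[of _ "145 * real n"] peaks_weight_A1_cond peaks_weight_set_integrable
      order_trans[OF zero_le_one peaks_weight_ge_one]) auto

text \<open>The upper bound turns \<open>n^2\<close> into the squared A_1 constant in the weak type
  estimate; the lower bound makes the constants tend to infinity.\<close>

lemma A1_const_peaks_weight:
  assumes "1 \<le> n"
  shows "n \<le> A1_const (peaks_weight n)" "A1_const (peaks_weight n) \<le> 145 * real n"
proof -
  have "145 * real n \<in> {C. C > 0 \<and> A1_cond (peaks_weight n) C}"
    using peaks_weight_A1_cond[OF assms] assms by simp
  then show "A1_const (peaks_weight n) \<le> 145 * real n"
    unfolding A1_const_def by (rule cInf_lower) (auto intro!: bdd_belowI[of _ 0])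
  show "n \<le> A1_const (peaks_weight n)"
    unfolding A1_const_def using peaks_weight_A1_cond[OF assms] assms
    by (intro cInf_greatest) (auto intro: A1_cond_peaks_weight_ge intro!: exI[of _ "145 * real n"])
qed

section \<open>Lower semicontinuity of the maximal function\<close>

text \<open>An interval whose average exceeds \<open>c\<close> keeps this property when slightly
  enlarged on both sides, and then contains a neighbourhood of \<open>x\<close>, even if
  \<open>x\<close> was an endpoint.\<close>

lemma open_maximal_fn_superlevel: "open {x. c < maximal_fn g x}"
  unfolding open_dist
proof safe
  fix x assume "c < maximal_fn g x"
  define J where "J = (\<lambda>a b. \<integral>\<^sup>+ y \<in> {a..b}. ennreal \<bar>g y\<bar> \<partial>lborel)"
  obtain a b where ab: "a < b" "a \<le> x" "x \<le> b" "c < ennreal (1 / (b - a)) * J a b"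
    using \<open>c < maximal_fn g x\<close> unfolding maximal_fn_def less_SUP_iff J_def by auto
  \<comment> \<open>Only the prefactor varies with \<open>t\<close>; the larger domain of
    integration enters afterwards by monotonicity.\<close>
  have "((\<lambda>t. ennreal (1 / ((b + t) - (a - t))) * J a b)
      \<longlongrightarrow> ennreal (1 / ((b + 0) - (a - 0))) * J a b) (at_right 0)"
    using ab by (intro tendsto_mult_ennreal tendsto_ennrealI tendsto_intros) auto
  then have "eventually (\<lambda>t. c < ennreal (1 / ((b + t) - (a - t))) * J a b) (at_right 0)"
    using ab by (intro order_tendstoD(1)) auto
  then have "eventually (\<lambda>t. c < ennreal (1 / ((b + t) - (a - t))) * J a b \<and> 0 < t) (at_right 0)"
    by (intro eventually_conj eventually_at_right_less)
  then obtain t where t: "t > 0" "c < ennreal (1 / ((b + t) - (a - t))) * J a b"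
    using eventually_happens'[OF trivial_limit_at_right_real] by blast
  have "c < maximal_fn g z" if "dist z x < t" for z
  proof -
    have "J a b \<le> J (a - t) (b + t)"
      unfolding J_def using t by (intro nn_integral_mono) (auto simp: indicator_def)
    then have "c < ennreal (1 / ((b + t) - (a - t))) * J (a - t) (b + t)"
      using t(2) by (meson less_le_trans mult_left_mono zero_le)
    also have "\<dots> \<le> maximal_fn g z"
      unfolding maximal_fn_def J_def using ab t that
      by (intro SUP_upper2[of "(a - t, b + t)"]) (auto simp: dist_real_def abs_if split: if_splits)
    finally show ?thesis .
  qed
  with t show "\<exists>e>0. \<forall>y. dist y x < e \<longrightarrow> y \<in> {x. c < maximal_fn g x}" by auto
qed

lemma maximal_fn_measurable [measurable]: "maximal_fn g \<in> borel_measurable borel"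
  by (rule borel_measurableI_greater) (simp add: open_maximal_fn_superlevel)

section \<open>The Hilbert transform of the unit interval\<close>

lemma has_bochner_integral_hilbert_kernel:
  fixes x p q :: real
  assumes "p \<le> q" "q < x \<or> x < p"
  shows "has_bochner_integral lborel (\<lambda>y. 1 / (x - y) * indicator {p..q} y) (ln \<bar>x - p\<bar> - ln \<bar>x - q\<bar>)"
proof (cases "q < x")
  case True
  have "has_bochner_integral lborel (\<lambda>y. 1 / (x - y) * indicator {p..q} y) (- ln (x - q) - (- ln (x - p)))"
    using assms True
    by (intro has_bochner_integral_FTC_Icc_nonneg[where F="\<lambda>y. - ln (x - y)"])
       (auto intro!: derivative_eq_intros simp: field_simps)
  with True assms show ?thesis by simp
next
  case False
  \<comment> \<open>Here \<open>x < p\<close> and the kernel is negative, so its negative is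
    integrated first.\<close>
  have "has_bochner_integral lborel (\<lambda>y. 1 / (y - x) * indicator {p..q} y) (ln (q - x) - ln (p - x))"
    using assms False
    by (intro has_bochner_integral_FTC_Icc_nonneg[where F="\<lambda>y. ln (y - x)"])
       (auto intro!: derivative_eq_intros simp: field_simps)
  then have "has_bochner_integral lborel (\<lambda>y. - (1 / (y - x) * indicator {p..q} y)) (- (ln (q - x) - ln (p - x)))"
    by (rule has_bochner_integral_minus)
  moreover have "- (1 / (y - x) * indicator {p..q} y) = 1 / (x - y) * indicator {p..q} y" for y
    using minus_divide_right[of "indicator {p..q} y" "y - x"] by simp
  ultimately show ?thesis using False assms by simp
qed

text \<open>The value does not depend on \<epsilon>: for \<open>x\<close> outside the open unit
  interval the truncation does not reach \<open>{0..1}\<close>, and for \<open>x\<close> inside it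
  the two terms \<open>ln \<epsilon>\<close> cancel.\<close>

lemma truncated_hilbert_unit_interval:
  fixes x \<epsilon> :: real
  assumes "0 < \<epsilon>" "\<epsilon> < \<bar>x\<bar>" "\<epsilon> < \<bar>x - 1\<bar>"
  shows "has_bochner_integral lborel
    (\<lambda>y. indicator {y. \<epsilon> < \<bar>x - y\<bar>} y *\<^sub>R (indicator {0..1} y / (x - y))) (ln \<bar>x\<bar> - ln \<bar>x - 1\<bar>)"
proof (cases "0 < x \<and> x < 1")
  case False
  have "has_bochner_integral lborel (\<lambda>y. 1 / (x - y) * indicator {0..1} y) (ln \<bar>x - 0\<bar> - ln \<bar>x - 1\<bar>)"
    using False assms by (intro has_bochner_integral_hilbert_kernel) auto
  moreover have "(\<lambda>y. indicator {y. \<epsilon> < \<bar>x - y\<bar>} y *\<^sub>R (indicator {0..1} y / (x - y)))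
      = (\<lambda>y. 1 / (x - y) * indicator {0..1} y)"
    using False assms by (auto simp: indicator_def abs_if fun_eq_iff split: if_splits)
  ultimately show ?thesis by (simp only: diff_zero)
next
  case True
  have "has_bochner_integral lborel
      (\<lambda>y. 1 / (x - y) * indicator {0..x - \<epsilon>} y + 1 / (x - y) * indicator {x + \<epsilon>..1} y)
      ((ln \<bar>x - 0\<bar> - ln \<bar>x - (x - \<epsilon>)\<bar>) + (ln \<bar>x - (x + \<epsilon>)\<bar> - ln \<bar>x - 1\<bar>))"
    using True assms
    by (intro has_bochner_integral_add has_bochner_integral_hilbert_kernel) auto
  \<comment> \<open>The strict truncation omits the points \<open>x - \<epsilon>\<close> and
    \<open>x + \<epsilon>\<close>, which the closed intervals contain, so the integrands agree only
    almost everywhere.\<close>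
  moreover have "has_bochner_integral lborel
      (\<lambda>y. indicator {y. \<epsilon> < \<bar>x - y\<bar>} y *\<^sub>R (indicator {0..1} y / (x - y))) I
    \<longleftrightarrow> has_bochner_integral lborel
      (\<lambda>y. 1 / (x - y) * indicator {0..x - \<epsilon>} y + 1 / (x - y) * indicator {x + \<epsilon>..1} y) I" for I
  proof (rule has_bochner_integral_cong_AE)
    show "AE y in lborel. indicator {y. \<epsilon> < \<bar>x - y\<bar>} y *\<^sub>R (indicator {0..1} y / (x - y))
      = 1 / (x - y) * indicator {0..x - \<epsilon>} y + 1 / (x - y) * indicator {x + \<epsilon>..1} y"
      using AE_lborel_singleton[of "x - \<epsilon>"] AE_lborel_singleton[of "x + \<epsilon>"]
      by eventually_elim (use True assms in \<open>auto simp: indicator_def abs_if split: if_splits\<close>)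
  qed measurable
  ultimately show ?thesis using assms by simp
qed

text \<open>The truncated integrals are eventually constant. Uniqueness of limits gives the
  equivalence, which puts the level sets of H in closed form for the measurability proof.\<close>

lemma hilbert_pv_unit_interval:
  assumes "x \<noteq> 0" "x \<noteq> 1"
  shows "hilbert_pv (indicator {0..1}) x L \<longleftrightarrow> L = ln \<bar>x\<bar> - ln \<bar>x - 1\<bar>"
proof -
  have small: "eventually (\<lambda>\<epsilon>. \<epsilon> \<in> {0<..<min \<bar>x\<bar> \<bar>x - 1\<bar>}) (at_right 0)"
    using assms by (intro eventually_at_right_real) auto
  have int: "eventually (\<lambda>\<epsilon>. set_integrable lborel {y. \<epsilon> < \<bar>x - y\<bar>} (\<lambda>y. indicator {0..1} y / (x - y))) (at_right 0)"
    using small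
    by eventually_elim (use truncated_hilbert_unit_interval[of _ x] in
        \<open>auto simp: set_integrable_def has_bochner_integral_iff\<close>)
  have val: "eventually (\<lambda>\<epsilon>. (LINT y:{y. \<epsilon> < \<bar>x - y\<bar>}|lborel. indicator {0..1} y / (x - y))
      = ln \<bar>x\<bar> - ln \<bar>x - 1\<bar>) (at_right 0)"
    using small
    by eventually_elim (use truncated_hilbert_unit_interval[of _ x] in
        \<open>auto simp: set_lebesgue_integral_def has_bochner_integral_iff\<close>)
  from val have "((\<lambda>\<epsilon>. LINT y:{y. \<epsilon> < \<bar>x - y\<bar>}|lborel. indicator {0..1} y / (x - y))
      \<longlongrightarrow> ln \<bar>x\<bar> - ln \<bar>x - 1\<bar>) (at_right 0)"
    by (rule tendsto_eventually)
  with int show ?thesis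
    unfolding hilbert_pv_def by (auto dest: tendsto_unique[OF trivial_limit_at_right_real])
qed

section \<open>The level sets: measurability and the plateaus inside them\<close>

lemma unit_interval_over_peaks_weight:
  "(\<lambda>y. indicator {0..1} y / peaks_weight n y) = indicator {0..1}"
  by (auto simp: indicator_def peaks_weight_unit_interval)

lemma level_M_measurable:
  assumes [measurable]: "w \<in> borel_measurable borel"
  shows "level_M w f \<alpha> \<in> sets borel"
  unfolding level_M_def by measurable

text \<open>Away from 0 and 1 the set is described by explicit logarithms; its part in
  \<open>{0, 1}\<close> is finite, hence closed, whatever the principal value does there.\<close>

lemma level_H_measurable:
  "level_H (peaks_weight n) (indicator {0..1}) \<alpha> \<in> sets borel"
proof -
  let ?S = "level_H (peaks_weight n) (indicator {0..1}) \<alpha>"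
  let ?R = "{x. x \<noteq> 0 \<and> x \<noteq> 1 \<and> \<alpha> < peaks_weight n x * abs (ln \<bar>x\<bar> - ln \<bar>x - 1\<bar>)}"
  have "?R \<in> sets borel" by measurable
  moreover have "?S \<inter> {0, 1} \<in> sets borel"
    by (intro borel_closed finite_imp_closed) auto
  ultimately have "?R \<union> (?S \<inter> {0, 1}) \<in> sets borel" by (rule sets.Un)
  also have "?R \<union> (?S \<inter> {0, 1}) = ?S"
    unfolding level_H_def unit_interval_over_peaks_weight
    by (auto simp: hilbert_pv_unit_interval)
  finally show ?thesis .
qed

text \<open>On a plateau \<open>x \<le> 2 * 2^k\<close>, while the weight is at least
  \<open>1 + n * 2^k\<close>; the summand 1 makes the inequality strict, as the level
  \<open>n / 2\<close> demands.\<close>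

lemma peaks_weight_div_gt:
  assumes "k \<in> {3..n+2}" "\<bar>x - 2^k\<bar> \<le> 1"
  shows "1 < x" "n / 2 < peaks_weight n x / x"
proof -
  have x: "x \<le> 2 * 2^k" "1 < x"
    using assms(2) dyadic_ge_8[OF assms(1)] unfolding abs_le_iff by linarith+
  then show "1 < x" by simp
  have "n / 2 * x \<le> n / 2 * (2 * 2^k)"
    using x by (intro mult_left_mono) auto
  also have "\<dots> < peaks_weight n x"
    using peaks_weight_near_peak[OF assms] by simp
  finally show "n / 2 < peaks_weight n x / x"
    using x by (simp add: less_divide_eq)
qed

lemma maximal_fn_unit_interval_ge:
  assumes "1 < x"
  shows "ennreal (1 / x) \<le> maximal_fn (indicator {0..1}) x"
proof -
  have "(\<integral>\<^sup>+ y \<in> {0..x}. ennreal \<bar>indicator {0..1} y\<bar> \<partial>lborel) = (\<integral>\<^sup>+ y. indicator {0..1::real} y \<partial>lborel)"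
    using assms by (intro nn_integral_cong) (auto simp: indicator_def)
  then have "(\<integral>\<^sup>+ y \<in> {0..x}. ennreal \<bar>indicator {0..1} y\<bar> \<partial>lborel) = 1"
    by simp
  then show ?thesis
    unfolding maximal_fn_def using assms by (intro SUP_upper2[of "(0, x)"]) auto
qed

text \<open>This gives H the same lower bound \<open>1 / x\<close> as M, so one level serves both
  operators.\<close>

lemma hilbert_unit_interval_ge:
  fixes x :: real
  assumes "1 < x"
  shows "1 / x \<le> ln \<bar>x\<bar> - ln \<bar>x - 1\<bar>"
proof -
  have "ln ((x - 1) / x) \<le> (x - 1) / x - 1"
    using assms by (intro ln_le_minus_one) auto
  also have "\<dots> = - (1 / x)" using assms by (simp add: field_simps)
  finally show ?thesis using assms by (simp add: ln_div)
qed

lemma level_M_supset: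
  assumes "k \<in> {3..n+2}" "\<bar>x - 2^k\<bar> \<le> 1"
  shows "x \<in> level_M (peaks_weight n) (indicator {0..1}) (n / 2)"
proof -
  note x = peaks_weight_div_gt[OF assms]
  have "0 < peaks_weight n x"
    by (rule less_le_trans[OF zero_less_one peaks_weight_ge_one])
  then have "ennreal (n / 2) < ennreal (peaks_weight n x * (1 / x))"
    using x by (intro ennreal_lessI) auto
  also have "\<dots> = ennreal (peaks_weight n x) * ennreal (1 / x)"
    using order_trans[OF zero_le_one peaks_weight_ge_one] x by (intro ennreal_mult) auto
  also have "\<dots> \<le> ennreal (peaks_weight n x) * maximal_fn (indicator {0..1}) x"
    using x by (intro mult_left_mono maximal_fn_unit_interval_ge) auto
  finally show ?thesis
    by (simp add: level_M_def unit_interval_over_peaks_weight)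
qed

lemma level_H_supset:
  assumes "k \<in> {3..n+2}" "\<bar>x - 2^k\<bar> \<le> 1"
  shows "x \<in> level_H (peaks_weight n) (indicator {0..1}) (n / 2)"
proof -
  note x = peaks_weight_div_gt[OF assms]
  note x(2)
  also have "peaks_weight n x / x = peaks_weight n x * (1 / x)" by simp
  also have "\<dots> \<le> peaks_weight n x * abs (ln \<bar>x\<bar> - ln \<bar>x - 1\<bar>)"
    using hilbert_unit_interval_ge[OF x(1)] order_trans[OF zero_le_one peaks_weight_ge_one]
    by (intro mult_left_mono) auto
  finally show ?thesis
    using x(1) unfolding level_H_def unit_interval_over_peaks_weight
    by (intro CollectI exI[of _ "ln \<bar>x\<bar> - ln \<bar>x - 1\<bar>"]) (simp add: hilbert_pv_unit_interval)
qed

text \<open>Since \<open>2^k \<ge> 8\<close>, the windows of radius 1 lie in the disjoint windows of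
  radius \<open>2^k / 4\<close>; there are \<open>n\<close> of them, each of length 2.\<close>

lemma emeasure_dyadic_windows_le:
  assumes "S \<in> sets borel" "\<And>k (x::real). k \<in> {3..n+2} \<Longrightarrow> \<bar>x - 2^k\<bar> \<le> 1 \<Longrightarrow> x \<in> S"
  shows "ennreal (2 * n) \<le> emeasure lebesgue S"
proof -
  define F where "F = (\<lambda>k::nat. {2^k - 1..2^k + 1 :: real})"
  have F: "\<bar>x - 2^k\<bar> \<le> 1" if "x \<in> F k" for x k
    using that by (auto simp: F_def abs_le_iff)
  have "disjoint_family_on F {3..n+2}"
    unfolding disjoint_family_on_def
  proof (intro ballI impI equals0I)
    fix k l x assume kl: "k \<in> {3..n+2}" "l \<in> {3..n+2}" "k \<noteq> l" "x \<in> F k \<inter> F l"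
    then have "\<bar>x - 2^k\<bar> \<le> 1" "\<bar>x - 2^l\<bar> \<le> 1" using F by auto
    then have "\<bar>x - 2^k\<bar> \<le> 2^k / 4" "\<bar>x - 2^l\<bar> \<le> 2^l / 4"
      using dyadic_ge_8[OF kl(1)] dyadic_ge_8[OF kl(2)] by linarith+
    then show False using dyadic_window_unique kl(3) by blast
  qed
  then have "(\<Sum>k\<in>{3..n+2}. emeasure lborel (F k)) = emeasure lborel (\<Union>k\<in>{3..n+2}. F k)"
    by (intro sum_emeasure) (auto simp: F_def)
  also have "\<dots> \<le> emeasure lborel S"
    using assms F by (intro emeasure_mono) auto
  finally show ?thesis
    using assms(1) by (simp add: F_def ennreal_of_nat_eq_real_of_nat ennreal_mult mult.commute)
qed

section \<open>The weak type quotient\<close>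

text \<open>\<open>S\<close> stands for the level sets of either operator. The level
  \<open>n / 2\<close> times the measure \<open>2 * n\<close> gives \<open>n^2\<close>, and
  \<open>n\<close> is at least the A_1 constant divided by 145.\<close>

lemma weak_type_constant_ge:
  assumes "1 \<le> n" "S (n / 2) \<in> sets borel" "\<And>k (x::real). k \<in> {3..n+2} \<Longrightarrow> \<bar>x - 2^k\<bar> \<le> 1 \<Longrightarrow> x \<in> S (n / 2)"
  shows "ennreal ((1 / 145\<^sup>2) * (A1_const (peaks_weight n))\<^sup>2 * (LINT x|lborel. \<bar>indicator {0..1::real} x\<bar>))
    \<le> (SUP \<alpha>\<in>{0<..}. ennreal \<alpha> * emeasure lebesgue (S \<alpha>))"
proof -
  have "(A1_const (peaks_weight n))\<^sup>2 \<le> (145 * real n)\<^sup>2"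
    using A1_const_peaks_weight[OF assms(1)] by (intro power_mono) auto
  then have "(1 / 145\<^sup>2) * (A1_const (peaks_weight n))\<^sup>2 * (LINT x|lborel. \<bar>indicator {0..1::real} x\<bar>)
      \<le> (real n)\<^sup>2"
    by (simp add: power_mult_distrib)
  then have "ennreal ((1 / 145\<^sup>2) * (A1_const (peaks_weight n))\<^sup>2 * (LINT x|lborel. \<bar>indicator {0..1::real} x\<bar>))
      \<le> ennreal (n / 2 * (2 * n))"
    by (intro ennreal_leI) (simp add: power2_eq_square)
  also have "\<dots> = ennreal (n / 2) * ennreal (2 * n)"
    by (rule ennreal_mult) auto
  also have "\<dots> \<le> ennreal (n / 2) * emeasure lebesgue (S (n / 2))"
    by (intro mult_left_mono emeasure_dyadic_windows_le assms) auto
  also have "\<dots> \<le> (SUP \<alpha>\<in>{0<..}. ennreal \<alpha> * emeasure lebesgue (S \<alpha>))"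
    using assms(1) by (intro SUP_upper) simp
  finally show ?thesis .
qed

theorem theorem1p1:
  shows "\<exists>c::real. c > 0 \<and> (\<exists>w :: nat \<Rightarrow> real \<Rightarrow> real.
     (\<forall>N. in_A1 (w N)) \<and>
     filterlim (\<lambda>N. A1_const (w N)) at_top sequentially \<and>
     (\<forall>N. \<exists>f :: real \<Rightarrow> real. integrable lborel f \<and> \<not> (AE x in lborel. f x = 0) \<and>
        (SUP \<alpha>\<in>{0<..}. ennreal \<alpha> * emeasure lebesgue (level_H (w N) f \<alpha>))
          \<ge> ennreal (c * (A1_const (w N))\<^sup>2 * (LINT x|lborel. \<bar>f x\<bar>)) \<and>
        (SUP \<alpha>\<in>{0<..}. ennreal \<alpha> * emeasure lebesgue (level_M (w N) f \<alpha>))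
          \<ge> ennreal (c * (A1_const (w N))\<^sup>2 * (LINT x|lborel. \<bar>f x\<bar>))))"
\<comment> \<open>\<open>Suc N\<close> keeps the number of peaks positive; one test function serves
  all the weights.\<close>
proof (intro exI[of _ "1 / 145\<^sup>2"] conjI exI[of _ "\<lambda>N. peaks_weight (Suc N)"] allI
    exI[of _ "indicator {0..1}"])
  show "filterlim (\<lambda>N. A1_const (peaks_weight (Suc N))) at_top sequentially"
  proof (rule filterlim_at_top_mono[OF filterlim_real_sequentially], intro always_eventually allI)
    fix N show "real N \<le> A1_const (peaks_weight (Suc N))"
      using A1_const_peaks_weight(1)[of "Suc N"] by simp
  qed
  show "integrable lborel (indicator {0..1::real} :: real \<Rightarrow> real)"
    by (intro integrable_real_indicator) auto
  show "\<not> (AE x in lborel. indicator {0..1::real} x = (0::real))"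
  proof
    assume "AE x in lborel. indicator {0..1::real} x = (0::real)"
    then have "AE x in lborel. x \<in> {0..1::real} \<longrightarrow> False"
      by eventually_elim (auto simp: indicator_def)
    from AE_lborel_Icc_witness[OF this] show False by simp
  qed
  fix N
  show "in_A1 (peaks_weight (Suc N))" by (rule in_A1_peaks_weight) simp
  show "ennreal (1 / 145\<^sup>2 * (A1_const (peaks_weight (Suc N)))\<^sup>2 * (LINT x|lborel. \<bar>indicator {0..1::real} x\<bar>))
      \<le> (SUP \<alpha>\<in>{0<..}. ennreal \<alpha> * emeasure lebesgue (level_H (peaks_weight (Suc N)) (indicator {0..1}) \<alpha>))"
    by (rule weak_type_constant_ge[where S="level_H (peaks_weight (Suc N)) (indicator {0..1})"])
      (simp, rule level_H_measurable, erule (1) level_H_supset)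
  show "ennreal (1 / 145\<^sup>2 * (A1_const (peaks_weight (Suc N)))\<^sup>2 * (LINT x|lborel. \<bar>indicator {0..1::real} x\<bar>))
      \<le> (SUP \<alpha>\<in>{0<..}. ennreal \<alpha> * emeasure lebesgue (level_M (peaks_weight (Suc N)) (indicator {0..1}) \<alpha>))"
    by (rule weak_type_constant_ge[where S="level_M (peaks_weight (Suc N)) (indicator {0..1})"])
      (simp, rule level_M_measurable[OF peaks_weight_measurable], erule (1) level_M_supset)
qed simp

end
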